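(* Let $R\to S\to T$ be homomorphisms of commutative rings such that $S$ is a weak content $R$-algebra and $T$ is a weak content $S$-algebra. Then $T$ is a weak content $R$-algebra.
   Context: All rings are commutative with $1$. Let $B$ be an $A$-algebra. For $f\in B$, the (Ohm-Rush) content of $f$ (relative to $A$) is the ideal $\Omega(f)=\Omega_{BA}(f) := \bigcap\{I \subseteq A \text{ ideal} \mid f\in IB\}$ of $A$. $B$ is an Ohm-Rush algebra over $A$ if $f\in\Omega(f)B$ for all $f\in B$. $B$ is a weak content algebra over $A$ if it is an Ohm-Rush $A$-algebra and $\Omega(f)\Omega(g)\subseteq\sqrt{\Omega(fg)}$ for all $f,g\in B$. *)

theory Defs
  imports "HOL-Algebra.Algebra"
begin

text \<open>
  An \<open>A\<close>-algebra \<open>B\<close> is given by its structure homomorphism \<open>h\<close>, that is, by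
  \<^term>\<open>ring_hom_cring A B h\<close>; the zero ring is not excluded.
\<close>

definition extended_ideal ::
  "('b, 'n) ring_scheme \<Rightarrow> ('a \<Rightarrow> 'b) \<Rightarrow> 'a set \<Rightarrow> 'b set"
  where "extended_ideal B h I = Idl\<^bsub>B\<^esub> (h ` I)"

definition radical :: "('a, 'm) ring_scheme \<Rightarrow> 'a set \<Rightarrow> 'a set"
  where "radical A I = {x \<in> carrier A. \<exists>n::nat. n > 0 \<and> x [^]\<^bsub>A\<^esub> n \<in> I}"

text \<open>
  For \<open>f \<in> carrier B\<close> the family below contains \<open>carrier A\<close>, so the intersection is over a
  nonempty family and needs no further restriction to the carrier.
\<close>

definition ohm_rush_content ::
  "('a, 'm) ring_scheme \<Rightarrow> ('b, 'n) ring_scheme \<Rightarrow> ('a \<Rightarrow> 'b) \<Rightarrow> 'b \<Rightarrow> 'a set"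
  where "ohm_rush_content A B h f = \<Inter>{I. ideal I A \<and> f \<in> extended_ideal B h I}"

locale ohm_rush_algebra = ring_hom_cring A B h
  for A :: "('a, 'm) ring_scheme" and B :: "('b, 'n) ring_scheme" and h :: "'a \<Rightarrow> 'b" +
  assumes mem_extended_content:
    "f \<in> carrier B \<Longrightarrow> f \<in> extended_ideal B h (ohm_rush_content A B h f)"

locale weak_content_algebra = ohm_rush_algebra A B h
  for A :: "('a, 'm) ring_scheme" and B :: "('b, 'n) ring_scheme" and h :: "'a \<Rightarrow> 'b" +
  assumes content_prod_subset_radical:
    "f \<in> carrier B \<Longrightarrow> g \<in> carrier B \<Longrightarrow>
      ideal_prod A (ohm_rush_content A B h f) (ohm_rush_content A B h g)
        \<subseteq> radical A (ohm_rush_content A B h (f \<otimes>\<^bsub>B\<^esub> g))"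

end

theory Submission
  imports Defs
begin

text \<open>
  In an Ohm-Rush algebra \<open>f \<in> IB\<close> holds exactly when \<open>\<Omega>(f) \<subseteq> I\<close>. Hence \<open>f \<in> IT\<close> holds exactly
  when \<open>\<Omega>(a) \<subseteq> I\<close> for all \<open>a \<in> \<Omega>(f) \<subseteq> S\<close>, a condition that is stable under
  intersections of ideals \<open>I\<close>; this gives the Ohm-Rush property of \<open>T\<close> over \<open>R\<close>.
  A weak content algebra extends radical ideals to radical ideals, because \<open>a\<^sup>2 \<in> IS\<close> forces
  \<open>\<Omega>(a)\<^sup>2 \<subseteq> I\<close>. So for \<open>I = \<surd>\<Omega>(fg)\<close> the ideal \<open>IS\<close> is radical and contains
  \<open>ab\<close> for all \<open>a \<in> \<Omega>(f)\<close>, \<open>b \<in> \<Omega>(g)\<close> in \<open>S\<close>; thus \<open>\<Omega>(a)\<Omega>(b) \<subseteq> I\<close>, and passing to the colon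
  ideals of \<open>I\<close> yields \<open>\<Omega>(f)\<Omega>(g) \<subseteq> I\<close> over \<open>R\<close>. No prime ideals are involved.
\<close>

lemma ring_hom_cring_comp:
  assumes "ring_hom_cring R S h" and "ring_hom_cring S T k"
  shows "ring_hom_cring R T (k \<circ> h)"
proof -
  interpret h: ring_hom_cring R S h by fact
  interpret k: ring_hom_cring S T k by fact
  show ?thesis
    by (intro ring_hom_cringI h.R.is_cring k.S.is_cring ring_hom_trans[OF h.homh k.homh])
qed

section \<open>Colon ideals and radicals in a commutative ring\<close>

context cring
begin

text \<open>This is the colon ideal \<open>(I : y)\<close>. It turns a statement about products into
  a containment in one ideal, the form that can be compared with contents.\<close>

lemma ideal_colon:
  assumes "ideal I R" "y \<in> carrier R"
  shows "ideal {x \<in> carrier R. x \<otimes> y \<in> I} R"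
proof -
  interpret ideal I R by fact
  have mult: "r \<otimes> x \<otimes> y \<in> I" if "r \<in> carrier R" "x \<in> carrier R" "x \<otimes> y \<in> I" for r x
    using that assms I_l_closed[of "x \<otimes> y" r] by (simp add: m_assoc)
  moreover have "x \<otimes> r \<otimes> y \<in> I" if "r \<in> carrier R" "x \<in> carrier R" "x \<otimes> y \<in> I" for r x
    using that mult by (simp add: m_comm[of x])
  ultimately show ?thesis
    using assms
    by (intro idealI ring_axioms subgroup.intro) (auto simp: l_distr l_minus simp flip: a_inv_def)
qed

text \<open>Replaces the binomial expansion: one factor \<open>x \<oplus> y\<close> is split off and
  its summands are absorbed into the multiplier \<open>c\<close>, which lowers \<open>n\<close> or
  \<open>m\<close> by one. The multiplier is there to make this induction go through; only
  \<open>c = \<one>\<close> is needed later.\<close>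

lemma pow_add_mem_ideal:
  assumes "ideal I R" "x \<in> carrier R" "y \<in> carrier R" "c \<in> carrier R"
    and "c \<otimes> x [^] (n::nat) \<in> I" "c \<otimes> y [^] (m::nat) \<in> I"
  shows "c \<otimes> (x \<oplus> y) [^] (n + m) \<in> I"
  using assms(4-)
proof (induction "n + m" arbitrary: n m c)
  case 0
  then show ?case by simp
next
  case (Suc l)
  interpret ideal I R by fact
  show ?case
  proof (cases "n = 0 \<or> m = 0")
    case True
    then have "c \<in> I" using Suc.prems by auto
    then show ?thesis using assms by (intro I_r_closed) auto
  next
    case False
    then obtain n' m' where nm: "n = Suc n'" "m = Suc m'" by (meson not0_implies_Suc)
    note [simp] = assms(2,3) Suc.prems(1)
    have "c \<otimes> x \<otimes> (x \<oplus> y) [^] (n' + m) \<in> I"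
    proof (rule Suc.hyps(1))
      show "c \<otimes> x \<otimes> x [^] n' \<in> I" using Suc.prems(2) nm
        nat_pow_Suc2[of x n'] by (simp add: m_assoc del: nat_pow_Suc)
      show "c \<otimes> x \<otimes> y [^] m \<in> I"
        using I_l_closed[OF Suc.prems(3), of x] by (simp add: m_ac del: nat_pow_Suc)
    qed (use Suc.hyps(2) nm in auto)
    moreover have "c \<otimes> y \<otimes> (x \<oplus> y) [^] (n + m') \<in> I"
    proof (rule Suc.hyps(1))
      show "c \<otimes> y \<otimes> y [^] m' \<in> I" using Suc.prems(3) nm
        nat_pow_Suc2[of y m'] by (simp add: m_assoc del: nat_pow_Suc)
      show "c \<otimes> y \<otimes> x [^] n \<in> I"
        using I_l_closed[OF Suc.prems(2), of y] by (simp add: m_ac del: nat_pow_Suc)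
    qed (use Suc.hyps(2) nm in auto)
    moreover have "c \<otimes> (x \<oplus> y) [^] (n + m) =
        c \<otimes> x \<otimes> (x \<oplus> y) [^] (n' + m) \<oplus> c \<otimes> y \<otimes> (x \<oplus> y) [^] (n + m')"
    proof -
      have "(x \<oplus> y) [^] (n + m) = (x \<oplus> y) \<otimes> (x \<oplus> y) [^] (n' + m)"
        using nm by (simp add: m_comm)
      moreover have "n + m' = n' + m" using nm by simp
      ultimately show ?thesis by (simp add: l_distr r_distr m_assoc)
    qed
    ultimately show ?thesis by simp
  qed
qed

lemma radical_ideal:
  assumes "ideal I R"
  shows "ideal (radical R I) R"
proof -
  interpret ideal I R by fact
  have mult: "r \<otimes> x \<in> radical R I" if "x \<in> radical R I" "r \<in> carrier R" for r x
    using that by (auto simp: radical_def nat_pow_distrib intro!: I_l_closed)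
  have add: "x \<oplus> y \<in> radical R I" if xy: "x \<in> radical R I" "y \<in> radical R I" for x y
  proof -
    from xy obtain n m :: nat where "n > 0" "x [^] n \<in> I" "y [^] m \<in> I"
      and [simp]: "x \<in> carrier R" "y \<in> carrier R"
      unfolding radical_def by auto
    then show ?thesis
      using pow_add_mem_ideal[OF assms, of x y \<one> n m] by (auto simp: radical_def intro!: exI[of _ "n + m"])
  qed
  have sub: "radical R I \<subseteq> carrier R" by (auto simp: radical_def)
  have zero: "\<zero> \<in> radical R I" by (auto simp: radical_def intro!: exI[of _ 1])
  have minus: "\<ominus> x \<in> radical R I" if "x \<in> radical R I" for x
    using mult[OF that, of "\<ominus> \<one>"] that sub by (auto simp: l_minus)
  show ?thesis
    using sub zero add minus mult
    by (intro idealI ring_axioms subgroup.intro) (auto simp: m_comm subset_eq simp flip: a_inv_def)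
qed

lemma subset_radical:
  assumes "I \<subseteq> carrier R" shows "I \<subseteq> radical R I"
  using assms by (auto simp: radical_def intro!: exI[of _ 1])

lemma radical_idem: "radical R (radical R I) = radical R I"
proof
  show "radical R (radical R I) \<subseteq> radical R I"
  proof
    fix x assume "x \<in> radical R (radical R I)"
    then obtain n m :: nat where "x \<in> carrier R" "n > 0" "m > 0" "(x [^] n) [^] m \<in> I"
      unfolding radical_def by auto
    then show "x \<in> radical R I"
      unfolding radical_def by (auto simp: nat_pow_pow intro!: exI[of _ "n * m"])
  qed
  show "radical R I \<subseteq> radical R (radical R I)"
    by (intro subset_radical) (auto simp: radical_def)
qed

lemma radical_subset_if_square:
  assumes "ideal I R" and square: "\<And>x. x \<in> carrier R \<Longrightarrow> x \<otimes> x \<in> I \<Longrightarrow> x \<in> I"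
  shows "radical R I \<subseteq> I"
proof
  interpret ideal I R by fact
  fix x assume "x \<in> radical R I"
  then obtain n :: nat where "n > 0" "x [^] n \<in> I" and [simp]: "x \<in> carrier R"
    unfolding radical_def by auto
  then show "x \<in> I"
  proof (induction n rule: less_induct)
    case (less n)
    show ?case
    proof (cases "n = 1")
      case True
      then show ?thesis using less.prems by simp
    next
      case False
      \<comment> \<open>Half of \<open>n\<close>, rounded up: \<open>2 * l\<close> reaches
        \<open>n\<close>, so the square of \<open>x [^] l\<close> lies in \<open>I\<close>, while
        \<open>l < n\<close> because \<open>n\<close> is at least 2.\<close>
      define l where "l = (n + 1) div 2"
      have l: "0 < l" "l < n" "n \<le> l + l"
        using False less.prems(1) unfolding l_def by auto
      have "x [^] l \<otimes> x [^] l = x [^] n \<otimes> x [^] (l + l - n)"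
        using l(3) by (simp add: nat_pow_mult)
      also have "\<dots> \<in> I"
        using less.prems(2) by (rule I_r_closed) simp
      finally have "x [^] l \<in> I"
        using square[of "x [^] l"] by simp
      then show ?thesis using less.IH l less.prems by blast
    qed
  qed
qed

end

section \<open>Extension of ideals and the content ideal\<close>

context ring_hom_cring
begin

lemma extended_ideal_ideal:
  assumes "ideal I R" shows "ideal (extended_ideal S h I) S"
  unfolding extended_ideal_def
  by (rule S.genideal_ideal) (use ideal.Icarr[OF assms] in auto)

lemma extended_ideal_subset_iff:
  assumes "ideal I R" "ideal J S"
  shows "extended_ideal S h I \<subseteq> J \<longleftrightarrow> h ` I \<subseteq> J"
  unfolding extended_ideal_def
  by (rule S.Idl_subset_ideal) (use assms ideal.Icarr[OF assms(1)] in auto)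

lemma image_subset_extended_ideal:
  assumes "ideal I R" shows "h ` I \<subseteq> extended_ideal S h I"
  using assms extended_ideal_ideal extended_ideal_subset_iff by blast

lemma extended_ideal_mono:
  assumes "ideal I R" "ideal J R" "I \<subseteq> J"
  shows "extended_ideal S h I \<subseteq> extended_ideal S h J"
  using assms extended_ideal_subset_iff[of I "extended_ideal S h J"]
    image_subset_extended_ideal[of J] extended_ideal_ideal by blast

lemma ideal_ohm_rush_content:
  assumes "f \<in> carrier S"
  shows "ideal (ohm_rush_content R S h f) R"
  unfolding ohm_rush_content_def
proof (rule R.i_Intersect)
  \<comment> \<open>The intersection of ideals needs a nonempty family; the unit ideal of
    \<open>R\<close> belongs to it, since its extension contains 1.\<close>
  have "\<one>\<^bsub>S\<^esub> \<in> extended_ideal S h (carrier R)"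
    using image_subset_extended_ideal[OF R.oneideal] R.one_closed hom_one by (metis image_subset_iff)
  then have "f \<in> extended_ideal S h (carrier R)"
    using ideal.one_imp_carrier[OF extended_ideal_ideal[OF R.oneideal]] assms by simp
  then show "{I. ideal I R \<and> f \<in> extended_ideal S h I} \<noteq> {}"
    using R.oneideal by blast
qed auto

end

section \<open>Transitivity of extension and of the Ohm-Rush property\<close>

lemma extended_ideal_comp:
  assumes "ring_hom_cring R S h" "ring_hom_cring S T k" "ideal I R"
  shows "extended_ideal T (k \<circ> h) I = extended_ideal T k (extended_ideal S h I)"
proof
  interpret h: ring_hom_cring R S h by fact
  interpret k: ring_hom_cring S T k by fact
  interpret kh: ring_hom_cring R T "k \<circ> h" using ring_hom_cring_comp assms by blast
  note IS = h.extended_ideal_ideal[OF assms(3)]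
  note IT = kh.extended_ideal_ideal[OF assms(3)]
  show "extended_ideal T (k \<circ> h) I \<subseteq> extended_ideal T k (extended_ideal S h I)"
    using kh.extended_ideal_subset_iff[OF assms(3) k.extended_ideal_ideal[OF IS]]
      h.image_subset_extended_ideal[OF assms(3)] k.image_subset_extended_ideal[OF IS] by auto
  have "extended_ideal S h I \<subseteq> {s \<in> carrier S. k s \<in> extended_ideal T (k \<circ> h) I}"
    using h.extended_ideal_subset_iff[OF assms(3) ring_hom_ring.ideal_vimage[OF ring_hom_ringI2[OF h.S.ring_axioms k.S.ring_axioms k.homh] IT]]
      kh.image_subset_extended_ideal[OF assms(3)] ideal.Icarr[OF assms(3)] by auto
  then show "extended_ideal T k (extended_ideal S h I) \<subseteq> extended_ideal T (k \<circ> h) I"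
    using k.extended_ideal_subset_iff[OF IS IT] by auto
qed

text \<open>From left to right, \<open>I\<close> is one of the ideals being intersected. From right
  to left, \<open>f\<close> lies in the extension of its content, and extension is monotone.\<close>

lemma (in ohm_rush_algebra) mem_extended_ideal_iff:
  assumes "ideal I A" "f \<in> carrier B"
  shows "f \<in> extended_ideal B h I \<longleftrightarrow> ohm_rush_content A B h f \<subseteq> I"
  using assms mem_extended_content[of f] extended_ideal_mono[OF ideal_ohm_rush_content[of f] assms(1)]
  by (auto simp: ohm_rush_content_def)

lemma ohm_rush_algebra_comp:
  assumes "ohm_rush_algebra R S h" "ohm_rush_algebra S T k"
  shows "ohm_rush_algebra R T (k \<circ> h)"
    and "\<And>I f. ideal I R \<Longrightarrow> f \<in> carrier T \<Longrightarrow> f \<in> extended_ideal T (k \<circ> h) I \<longleftrightarrow>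
      (\<forall>a\<in>ohm_rush_content S T k f. ohm_rush_content R S h a \<subseteq> I)"
proof -
  interpret h: ohm_rush_algebra R S h by fact
  interpret k: ohm_rush_algebra S T k by fact
  interpret kh: ring_hom_cring R T "k \<circ> h"
    using ring_hom_cring_comp h.ring_hom_cring_axioms k.ring_hom_cring_axioms by blast
  show iff: "f \<in> extended_ideal T (k \<circ> h) I \<longleftrightarrow>
      (\<forall>a\<in>ohm_rush_content S T k f. ohm_rush_content R S h a \<subseteq> I)"
    if "ideal I R" "f \<in> carrier T" for I f
    using extended_ideal_comp[OF h.ring_hom_cring_axioms k.ring_hom_cring_axioms that(1)]
      k.mem_extended_ideal_iff[OF h.extended_ideal_ideal[OF that(1)] that(2)]
      h.mem_extended_ideal_iff[OF that(1)] ideal.Icarr[OF k.ideal_ohm_rush_content[OF that(2)]]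
    by blast
  show "ohm_rush_algebra R T (k \<circ> h)"
  proof
    fix f assume f: "f \<in> carrier T"
    \<comment> \<open>By \<open>iff\<close>, every \<open>I\<close> in the intersection defining the
      content of \<open>f\<close> over \<open>R\<close> contains the content of
      \<open>a\<close>.\<close>
    have "ohm_rush_content R S h a \<subseteq> ohm_rush_content R T (k \<circ> h) f"
      if "a \<in> ohm_rush_content S T k f" for a
      unfolding ohm_rush_content_def[of R T] using iff f that by blast
    then show "f \<in> extended_ideal T (k \<circ> h) (ohm_rush_content R T (k \<circ> h) f)"
      using iff[OF kh.ideal_ohm_rush_content[OF f] f] by blast
  qed
qed

section \<open>Radical ideals under weak content extensions\<close>

context weak_content_algebra
begin

text \<open>The product \<open>xy\<close> lies in the radical of the content of \<open>ab\<close>,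
  and that content lies in the radical ideal \<open>I\<close>. The main proof uses this twice: over
  \<open>S\<close> for the extended ideal and over \<open>R\<close> for \<open>I\<close>
  itself.\<close>

lemma content_mult_mem_radical_ideal:
  assumes "ideal I A" "radical A I \<subseteq> I" "a \<in> carrier B" "b \<in> carrier B"
    and "a \<otimes>\<^bsub>B\<^esub> b \<in> extended_ideal B h I"
    and "x \<in> ohm_rush_content A B h a" "y \<in> ohm_rush_content A B h b"
  shows "x \<otimes>\<^bsub>A\<^esub> y \<in> I"
proof -
  have "x \<otimes>\<^bsub>A\<^esub> y \<in> ideal_prod A (ohm_rush_content A B h a) (ohm_rush_content A B h b)"
    using assms(6,7) by (rule ideal_prod.prod)
  then have "x \<otimes>\<^bsub>A\<^esub> y \<in> radical A (ohm_rush_content A B h (a \<otimes>\<^bsub>B\<^esub> b))"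
    using content_prod_subset_radical assms(3,4) by blast
  moreover have "ohm_rush_content A B h (a \<otimes>\<^bsub>B\<^esub> b) \<subseteq> I"
    using mem_extended_ideal_iff assms(1,3-5) by simp
  ultimately show ?thesis
    using assms(2) by (auto simp: radical_def)
qed

text \<open>Makes the extended ideal a legitimate choice of radical ideal one level up. Testing
  squares is enough, and for these the preceding lemma applies with both factors equal to
  \<open>a\<close>.\<close>

lemma radical_extended_ideal:
  assumes "ideal I A" "radical A I \<subseteq> I"
  shows "radical B (extended_ideal B h I) \<subseteq> extended_ideal B h I"
proof (rule S.radical_subset_if_square)
  show "ideal (extended_ideal B h I) B"
    using assms(1) by (rule extended_ideal_ideal)
  fix a assume a: "a \<in> carrier B" "a \<otimes>\<^bsub>B\<^esub> a \<in> extended_ideal B h I"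
  have "x \<in> I" if x: "x \<in> ohm_rush_content A B h a" for x
  proof -
    have "x \<in> carrier A"
      using x ideal.Icarr[OF ideal_ohm_rush_content[OF a(1)]] by blast
    moreover have "x \<otimes>\<^bsub>A\<^esub> x \<in> I"
      using content_mult_mem_radical_ideal[OF assms a(1) a(1) a(2) x x] .
    ultimately have "x \<in> radical A I"
      by (auto simp: radical_def numeral_2_eq_2 intro!: exI[of _ 2])
    then show ?thesis using assms(2) by blast
  qed
  then show "a \<in> extended_ideal B h I"
    using mem_extended_ideal_iff[OF assms(1) a(1)] by blast
qed

end

section \<open>Transitivity of the weak content property\<close>

theorem corollary3p9:
  fixes R :: "('a, 'm) ring_scheme" and S :: "('b, 'n) ring_scheme" and T :: "('c, 'p) ring_scheme"
    and h :: "'a \<Rightarrow> 'b" and k :: "'b \<Rightarrow> 'c"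
  assumes "ring_hom_cring R S h"
    and "ring_hom_cring S T k"
    and "weak_content_algebra R S h"
    and "weak_content_algebra S T k"
  shows "weak_content_algebra R T (k \<circ> h)"
proof -
  interpret h: weak_content_algebra R S h by fact
  interpret k: weak_content_algebra S T k by fact
  interpret kh: ohm_rush_algebra R T "k \<circ> h"
    using ohm_rush_algebra_comp(1) h.ohm_rush_algebra_axioms k.ohm_rush_algebra_axioms by blast
  note mem_iff = ohm_rush_algebra_comp(2)[OF h.ohm_rush_algebra_axioms k.ohm_rush_algebra_axioms]
  let ?\<Omega>S = "ohm_rush_content S T k" and ?\<Omega>R = "ohm_rush_content R S h"
    and ?\<Omega> = "ohm_rush_content R T (k \<circ> h)"
  show ?thesis
  proof
    fix f g assume f: "f \<in> carrier T" and g: "g \<in> carrier T"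
    then have fg: "f \<otimes>\<^bsub>T\<^esub> g \<in> carrier T" by simp
    define I where "I = radical R (?\<Omega> (f \<otimes>\<^bsub>T\<^esub> g))"
    have I: "ideal I R" "radical R I \<subseteq> I"
      unfolding I_def using kh.ideal_ohm_rush_content[OF fg]
      by (simp_all add: h.R.radical_ideal h.R.radical_idem)
    have IS: "ideal (extended_ideal S h I) S"
      using I(1) by (rule h.extended_ideal_ideal)
    have "?\<Omega> (f \<otimes>\<^bsub>T\<^esub> g) \<subseteq> I"
      unfolding I_def using ideal.Icarr[OF kh.ideal_ohm_rush_content[OF fg]]
      by (intro h.R.subset_radical) blast
    then have fgI: "f \<otimes>\<^bsub>T\<^esub> g \<in> extended_ideal T k (extended_ideal S h I)"
      using kh.mem_extended_ideal_iff[OF I(1) fg] extended_ideal_comp[OF assms(1,2) I(1)] by simp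
    have \<Omega>S_carr: "a \<in> carrier S" if "a \<in> ?\<Omega>S f \<or> a \<in> ?\<Omega>S g" for a
      using that ideal.Icarr[OF k.ideal_ohm_rush_content] f g by blast
    have \<Omega>R_carr: "x \<in> carrier R" if "x \<in> ?\<Omega>R a" "a \<in> carrier S" for x a
      using that ideal.Icarr[OF h.ideal_ohm_rush_content] by blast
    \<comment> \<open>Descent in two stages: from \<open>fg\<close> in \<open>(IS)T\<close> to
      \<open>ab\<close> in \<open>IS\<close>, then from \<open>ab\<close> to \<open>xy\<close> in
      \<open>I\<close>.\<close>
    have xy: "x \<otimes>\<^bsub>R\<^esub> y \<in> I"
      if "a \<in> ?\<Omega>S f" "b \<in> ?\<Omega>S g" "x \<in> ?\<Omega>R a" "y \<in> ?\<Omega>R b" for a b x y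
      using that \<Omega>S_carr
        k.content_mult_mem_radical_ideal[OF IS h.radical_extended_ideal[OF I] f g fgI that(1,2)]
        h.content_mult_mem_radical_ideal[OF I]
      by blast
    \<comment> \<open>With \<open>y\<close> fixed, the colon ideal of \<open>I\<close> by
      \<open>y\<close> contains the contents over \<open>R\<close> of all \<open>a\<close> in
      \<open>?\<Omega>S f\<close>. By \<open>mem_iff\<close> it then contains
      \<open>?\<Omega> f\<close>.\<close>
    have xy': "x \<otimes>\<^bsub>R\<^esub> y \<in> I" if x: "x \<in> ?\<Omega> f" and b: "b \<in> ?\<Omega>S g" and y: "y \<in> ?\<Omega>R b" for x b y
    proof -
      let ?J = "{x \<in> carrier R. x \<otimes>\<^bsub>R\<^esub> y \<in> I}"
      have J: "ideal ?J R"
        using \<Omega>R_carr \<Omega>S_carr b y by (intro h.R.ideal_colon I(1)) blast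
      have "\<forall>a\<in>?\<Omega>S f. ?\<Omega>R a \<subseteq> ?J"
        using xy[OF _ b _ y] \<Omega>R_carr \<Omega>S_carr by blast
      then have "?\<Omega> f \<subseteq> ?J"
        using mem_iff[OF J f] kh.mem_extended_ideal_iff[OF J f] by blast
      then show ?thesis using x by blast
    qed
    \<comment> \<open>The same argument in the other factor, now with the colon ideal by a fixed
      \<open>x\<close> from \<open>?\<Omega> f\<close>.\<close>
    have prod: "x \<otimes>\<^bsub>R\<^esub> y \<in> I" if x: "x \<in> ?\<Omega> f" and y: "y \<in> ?\<Omega> g" for x y
    proof -
      let ?J = "{y \<in> carrier R. y \<otimes>\<^bsub>R\<^esub> x \<in> I}"
      have x_carr: "x \<in> carrier R"
        using ideal.Icarr[OF kh.ideal_ohm_rush_content[OF f]] x by blast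
      have J: "ideal ?J R"
        using x_carr by (intro h.R.ideal_colon I(1))
      have "z \<in> ?J" if "b \<in> ?\<Omega>S g" "z \<in> ?\<Omega>R b" for b z
      proof -
        have "z \<in> carrier R" using \<Omega>R_carr \<Omega>S_carr that by blast
        then show ?thesis using xy'[OF x that] h.R.m_comm[OF x_carr, of z] by simp
      qed
      then have "?\<Omega> g \<subseteq> ?J"
        using mem_iff[OF J g] kh.mem_extended_ideal_iff[OF J g] by blast
      then have "y \<in> carrier R" "y \<otimes>\<^bsub>R\<^esub> x \<in> I" using y by auto
      then show ?thesis using h.R.m_comm[OF x_carr, of y] by simp
    qed
    show "ideal_prod R (?\<Omega> f) (?\<Omega> g) \<subseteq> radical R (?\<Omega> (f \<otimes>\<^bsub>T\<^esub> g))"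
    proof
      fix z assume "z \<in> ideal_prod R (?\<Omega> f) (?\<Omega> g)"
      then have "z \<in> I"
        by induction (use prod additive_subgroup.a_closed[OF ideal.axioms(1)[OF I(1)]] in auto)
      then show "z \<in> radical R (?\<Omega> (f \<otimes>\<^bsub>T\<^esub> g))" by (simp add: I_def)
    qed
  qed
qed

end
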